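(* In the revocable setting of OWNM, even when all weights equal $1$, no deterministic online algorithm can achieve a competitive ratio better than $2/3$.
   Context: Online Weighted Non-Crossing Matching (OWNM): the input is a sequence $p_1,\dots,p_{2n}$ of points in the Euclidean plane in general position, revealed online one at a time; when $p_i$ arrives its weight $w(p_i)>0$ is revealed. Upon arrival an algorithm either leaves $p_i$ unmatched or matches it with a previously arrived, currently unmatched point, subject to the constraint that the straight-line segments joining matched pairs are pairwise non-crossing. Revocable setting: when a new point arrives, the algorithm may first (irrevocably) remove one existing edge from the current matching, making its endpoints unmatched and available, and then process the new point. The profit $\textsc{ALG}(I)$ is the total weight of the points matched in the final matching; $\textsc{OPT}(I)=\sum_i w(p_i)$. A deterministic algorithm is $\rho$-competitive if there is a constant $c$ with $\textsc{ALG}(I)\ge\rho\,\textsc{OPT}(I)-c$ for all $I$; the competitive ratio is the supremum of such $\rho$. *)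

theory Defs
  imports "HOL-Analysis.Analysis"
begin

type_synonym point = "real^2"

text \<open>An input is the list of arriving points, each with its weight.\<close>

type_synonym input = "(point \<times> real) list"

text \<open>An edge is the set of its two endpoints, and a matching is a set of edges.\<close>

type_synonym matching = "point set set"

definition general_position :: "point set \<Rightarrow> bool" where
  "general_position S \<longleftrightarrow> (\<forall>T\<subseteq>S. card T = 3 \<longrightarrow> \<not> collinear T)"

definition ownm_inputs :: "input set" where
  "ownm_inputs = {I. even (length I) \<and> distinct (map fst I) \<and>
     general_position (fst ` set I) \<and> (\<forall>(p, w)\<in>set I. w > 0)}"

definition unit_weight_inputs :: "input set" where
  "unit_weight_inputs = {I\<in>ownm_inputs. \<forall>(p, w)\<in>set I. w = 1}"

text \<open>
  The convex hull of an edge \<open>{a, b}\<close> is the closed segment from \<open>a\<close> to \<open>b\<close>. Edges of a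
  matching on points in general position have disjoint endpoints, none of which lies on another
  edge, so two of them cross exactly if the closed segments meet.
\<close>

definition non_crossing :: "matching \<Rightarrow> bool" where
  "non_crossing M \<longleftrightarrow>
     (\<forall>e\<in>M. \<forall>f\<in>M. e \<noteq> f \<longrightarrow> convex hull e \<inter> convex hull f = {})"

text \<open>
  A deterministic online algorithm maps the prefix of the input revealed so far, whose last entry
  is the new point, to the edge to be removed (if any) and the point to be matched with the new
  point (if any). It does not know the length of the input.
\<close>

type_synonym decision = "point set option \<times> point option"
type_synonym algorithm = "input \<Rightarrow> decision"

definition remove_edge :: "point set option \<Rightarrow> matching \<Rightarrow> matching" where
  "remove_edge r M = (case r of None \<Rightarrow> M | Some e \<Rightarrow> M - {e})"

definition add_edge :: "point \<Rightarrow> point option \<Rightarrow> matching \<Rightarrow> matching" where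
  "add_edge p m M = (case m of None \<Rightarrow> M | Some q \<Rightarrow> insert {p, q} M)"

primrec matching_after :: "algorithm \<Rightarrow> input \<Rightarrow> nat \<Rightarrow> matching" where
  "matching_after A I 0 = {}"
| "matching_after A I (Suc k) =
     (let (r, m) = A (take (Suc k) I)
      in add_edge (fst (I ! k)) m (remove_edge r (matching_after A I k)))"

definition legal_decision :: "point set \<Rightarrow> point \<Rightarrow> matching \<Rightarrow> decision \<Rightarrow> bool" where
  "legal_decision S p M d \<longleftrightarrow>
     (let (r, m) = d; M' = remove_edge r M
      in (\<forall>e. r = Some e \<longrightarrow> e \<in> M) \<and>
         (\<forall>q. m = Some q \<longrightarrow> q \<in> S \<and> q \<notin> \<Union>M') \<and>
         non_crossing (add_edge p m M'))"

definition revocable_algorithm :: "input set \<Rightarrow> algorithm \<Rightarrow> bool" where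
  "revocable_algorithm \<I> A \<longleftrightarrow>
     (\<forall>I\<in>\<I>. \<forall>k<length I.
        legal_decision (fst ` set (take k I)) (fst (I ! k)) (matching_after A I k)
          (A (take (Suc k) I)))"

definition alg_profit :: "algorithm \<Rightarrow> input \<Rightarrow> real" where
  "alg_profit A I = (\<Sum>(p, w)\<leftarrow>I. if p \<in> \<Union>(matching_after A I (length I)) then w else 0)"

text \<open>A set of evenly many points in general position has a perfect non-crossing matching.\<close>

definition opt_profit :: "input \<Rightarrow> real" where
  "opt_profit I = (\<Sum>(p, w)\<leftarrow>I. w)"

definition competitive :: "input set \<Rightarrow> algorithm \<Rightarrow> real \<Rightarrow> bool" where
  "competitive \<I> A \<rho> \<longleftrightarrow> (\<exists>c. \<forall>I\<in>\<I>. alg_profit A I \<ge> \<rho> * opt_profit I - c)"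

definition competitive_ratio :: "input set \<Rightarrow> algorithm \<Rightarrow> ereal" where
  "competitive_ratio \<I> A = Sup {ereal \<rho> |\<rho>. competitive \<I> A \<rho>}"

end

theory Submission
  imports Defs
begin

text \<open>
  All points lie on the parabola \<open>y = x\<^sup>2\<close>, so that chords with interleaving endpoints cross.
  The adversary keeps \<open>3 e \<le> n + 2\<close>, where \<open>e\<close> is the number of edges after \<open>n\<close> points.
  If \<open>3 e \<le> n\<close>, any new point will do, since \<open>e\<close> grows by at most one.
  Otherwise there are fewer unmatched points than edges. Assign to each unmatched point the
  largest left endpoint of an edge lying above it. Some edge \<open>{a, b}\<close> has a left endpoint that
  is not assigned, and a new point immediately to the right of \<open>a\<close> is separated by an edge from
  every unmatched point. Hence it can only be matched after an edge has been removed, and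
  \<open>e\<close> does not grow.
\<close>

section \<open>Points and chords of the parabola\<close>

definition parabola_point :: "real \<Rightarrow> point" where
  "parabola_point x = vector [x, x\<^sup>2]"

lemma parabola_point_nth [simp]:
  "parabola_point x $ 1 = x" "parabola_point x $ 2 = x\<^sup>2"
  by (simp_all add: parabola_point_def)

lemma inj_parabola_point: "inj parabola_point"
  by (metis injI parabola_point_nth(1))

lemma parabola_point_eq_iff [simp]: "parabola_point x = parabola_point y \<longleftrightarrow> x = y"
  by (rule inj_eq[OF inj_parabola_point])

text \<open>The cross product of the two difference vectors is the Vandermonde product
  \<open>(b - a) * (c - a) * (c - b)\<close>, which vanishes only if two abscissae agree.\<close>

lemma parabola_not_collinear:
  assumes "a \<noteq> b" "a \<noteq> c" "b \<noteq> c"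
  shows "\<not> collinear {parabola_point a, parabola_point b, parabola_point c}"
proof
  assume "collinear {parabola_point a, parabola_point b, parabola_point c}"
  then obtain u s t where s: "parabola_point b - parabola_point a = s *\<^sub>R u"
    and t: "parabola_point c - parabola_point a = t *\<^sub>R u"
    unfolding collinear_def by blast
  have s1: "b - a = s * u $ 1" and s2: "b\<^sup>2 - a\<^sup>2 = s * u $ 2"
    using arg_cong[OF s, of "\<lambda>v. v $ 1"] arg_cong[OF s, of "\<lambda>v. v $ 2"] by simp_all
  have t1: "c - a = t * u $ 1" and t2: "c\<^sup>2 - a\<^sup>2 = t * u $ 2"
    using arg_cong[OF t, of "\<lambda>v. v $ 1"] arg_cong[OF t, of "\<lambda>v. v $ 2"] by simp_all
  have "(b - a) * (c\<^sup>2 - a\<^sup>2) = (c - a) * (b\<^sup>2 - a\<^sup>2)"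
    unfolding s1 s2 t1 t2 by simp
  then have "(b - a) * (c - a) * (c - b) = 0"
    by (simp add: algebra_simps power2_eq_square)
  with assms show False by simp
qed

lemma parabola_general_position: "general_position (parabola_point ` X)"
  unfolding general_position_def
proof (intro allI impI)
  fix T assume T: "T \<subseteq> parabola_point ` X" "card T = 3"
  then obtain Y where "T = parabola_point ` Y"
    by (auto simp: subset_image_iff)
  moreover have "card Y = 3"
    using T(2) calculation by (simp add: card_image inj_on_def)
  ultimately show "\<not> collinear T"
    using parabola_not_collinear by (auto simp: card_3_iff)
qed

text \<open>The line through the two parabola points is \<open>y = (a + b) * x - a * b\<close>. The
  affine parameter of \<open>x\<close> between \<open>a\<close> and \<open>b\<close> also produces
  the second coordinate.\<close>

lemma parabola_chord_mem:
  assumes "a < b" "a \<le> x" "x \<le> b" "v $ 1 = x" "v $ 2 = (a + b) * x - a * b"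
  shows "v \<in> convex hull {parabola_point a, parabola_point b}"
proof -
  define t where "t = (x - a) / (b - a)"
  have tx: "t * (b - a) = x - a"
    using assms(1) by (simp add: t_def)
  have "(1 - t) * a + t * b = x"
    using tx by (simp add: algebra_simps)
  moreover have "(1 - t) * a\<^sup>2 + t * b\<^sup>2 = (a + b) * x - a * b"
  proof -
    have "(1 - t) * a\<^sup>2 + t * b\<^sup>2 = a\<^sup>2 + t * (b - a) * (a + b)"
      by (simp add: algebra_simps power2_eq_square)
    then show ?thesis
      unfolding tx by (simp add: algebra_simps power2_eq_square)
  qed
  ultimately have "v = (1 - t) *\<^sub>R parabola_point a + t *\<^sub>R parabola_point b"
    using assms(4,5) by (simp add: vec_eq_iff forall_2)
  moreover have "0 \<le> t" "t \<le> 1"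
    using assms(1-3) by (simp_all add: t_def)
  ultimately show ?thesis
    by (auto simp: segment_convex_hull[symmetric] in_segment)
qed

lemma parabola_chords_cross:
  assumes "a < c" "c < b" "b < d"
  shows "convex hull {parabola_point a, parabola_point b} \<inter>
    convex hull {parabola_point c, parabola_point d} \<noteq> {}"
proof -
  \<comment> \<open>\<open>D\<close> is the difference of the slopes of the two chords, and
    \<open>x\<close> is the abscissa where their lines meet.\<close>
  define D where "D = c + d - a - b"
  define x where "x = (c * d - a * b) / D"
  define v :: point where "v = vector [x, (a + b) * x - a * b]"
  have D: "D > 0" using assms by (simp add: D_def)
  have xD: "x * D = c * d - a * b" using D by (simp add: x_def)
  \<comment> \<open>The factored forms reveal the signs: the meeting point lies over the interval
    between \<open>c\<close> and \<open>b\<close>, which both chords span.\<close>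
  have "(x - c) * D = (c - a) * (b - c)" "(b - x) * D = (b - c) * (d - b)"
    using xD by (simp_all add: D_def algebra_simps)
  then have "0 < (x - c) * D" "0 < (b - x) * D"
    using assms by simp_all
  then have x: "c < x" "x < b"
    using D by (simp_all add: zero_less_mult_iff)
  have "(a + b) * x - a * b = (c + d) * x - c * d"
    using xD by (simp add: D_def algebra_simps)
  then have "v \<in> convex hull {parabola_point a, parabola_point b}"
    "v \<in> convex hull {parabola_point c, parabola_point d}"
    using assms x parabola_chord_mem[of a b x v] parabola_chord_mem[of c d x v]
    by (simp_all add: v_def)
  then show ?thesis by blast
qed

section \<open>Runs of an algorithm on points of the parabola\<close>

definition parabola_input :: "real list \<Rightarrow> input" where
  "parabola_input xs = map (\<lambda>x. (parabola_point x, 1)) xs"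

lemma length_parabola_input [simp]: "length (parabola_input xs) = length xs"
  by (simp add: parabola_input_def)

lemma parabola_input_append: "parabola_input (xs @ ys) = parabola_input xs @ parabola_input ys"
  by (simp add: parabola_input_def)

lemma fst_set_parabola_input: "fst ` set (parabola_input xs) = parabola_point ` set xs"
  by (force simp: parabola_input_def)

lemma parabola_input_unit_weight:
  assumes "distinct xs" "even (length xs)"
  shows "parabola_input xs \<in> unit_weight_inputs"
  using assms parabola_general_position[of "set xs"]
  by (auto simp: unit_weight_inputs_def ownm_inputs_def fst_set_parabola_input)
     (auto simp: parabola_input_def distinct_map inj_on_def o_def)

lemma opt_profit_parabola_input: "opt_profit (parabola_input xs) = length xs"
  by (induction xs) (auto simp: opt_profit_def parabola_input_def)

text \<open>Decisions depend on prefixes only, so the adversary can prolong an input without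
  altering the run so far.\<close>

lemma matching_after_append:
  "k \<le> length I \<Longrightarrow> matching_after A (I @ J) k = matching_after A I k"
  by (induction k) (auto simp: nth_append)

definition parabola_matching :: "algorithm \<Rightarrow> real list \<Rightarrow> matching" where
  "parabola_matching A xs = matching_after A (parabola_input xs) (length xs)"

lemma parabola_matching_Nil [simp]: "parabola_matching A [] = {}"
  by (simp add: parabola_matching_def)

lemma parabola_matching_snoc:
  assumes "A (parabola_input (xs @ [x])) = (r, m)"
  shows "parabola_matching A (xs @ [x]) =
    add_edge (parabola_point x) m (remove_edge r (parabola_matching A xs))"
  using assms
  by (simp add: parabola_matching_def parabola_input_append matching_after_append nth_append)
     (simp add: parabola_input_def)

text \<open>Legality is assumed only along complete inputs, which have even length. A list of odd
  length is padded with one fresh point \<open>y\<close>; the decision in question sees only the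
  prefix before it.\<close>

lemma parabola_legal_decision:
  assumes A: "revocable_algorithm \<I> A" and sub: "unit_weight_inputs \<subseteq> \<I>"
    and "distinct (xs @ [x])"
  shows "legal_decision (parabola_point ` set xs) (parabola_point x) (parabola_matching A xs)
    (A (parabola_input (xs @ [x])))"
proof -
  obtain y where y: "y \<notin> set (xs @ [x])"
    using ex_new_if_finite[OF infinite_UNIV_char_0 finite_set] by blast
  define zs where "zs = (if even (length (xs @ [x])) then [] else [y])"
  define I where "I = parabola_input (xs @ [x] @ zs)"
  have "I \<in> \<I>"
    using assms y sub unfolding I_def
    by (intro subsetD[OF sub] parabola_input_unit_weight) (auto simp: zs_def)
  moreover have "length xs < length I" by (simp add: I_def)
  ultimately have "legal_decision (fst ` set (take (length xs) I)) (fst (I ! length xs))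
      (matching_after A I (length xs)) (A (take (Suc (length xs)) I))"
    using A unfolding revocable_algorithm_def by blast
  moreover have "take (length xs) I = parabola_input xs"
    "take (Suc (length xs)) I = parabola_input (xs @ [x])"
    "fst (I ! length xs) = parabola_point x"
    by (simp_all add: I_def parabola_input_def nth_append)
  moreover have "matching_after A I (length xs) = parabola_matching A xs"
    by (simp add: I_def parabola_input_append matching_after_append parabola_matching_def)
  ultimately show ?thesis by (simp add: fst_set_parabola_input)
qed

section \<open>Matchings and their profit\<close>

definition matching_on :: "point set \<Rightarrow> matching \<Rightarrow> bool" where
  "matching_on S M \<longleftrightarrow> (\<forall>e\<in>M. e \<subseteq> S \<and> card e = 2) \<and> pairwise disjnt M"

lemma matching_on_finite:
  assumes "matching_on S M" "finite S"
  shows "finite M" "finite (\<Union>M)"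
proof -
  have "\<Union>M \<subseteq> S" using assms(1) by (auto simp: matching_on_def)
  with assms(2) show "finite (\<Union>M)" by (rule finite_subset[rotated])
  then show "finite M" by (rule finite_UnionD)
qed

lemma matching_on_card_Union:
  assumes "matching_on S M" "finite S"
  shows "card (\<Union>M) = 2 * card M"
proof -
  have "card (\<Union>M) = sum card M"
    using assms by (intro card_Union_disjoint)
      (auto simp: matching_on_def intro: finite_subset)
  also have "\<dots> = 2 * card M"
    using assms by (simp add: matching_on_def)
  finally show ?thesis .
qed

text \<open>A shared endpoint would lie in both convex hulls.\<close>

lemma non_crossing_pairwise_disjnt:
  assumes "non_crossing M"
  shows "pairwise disjnt M"
  unfolding pairwise_def disjnt_def
proof (intro ballI impI)
  fix e f assume "e \<in> M" "f \<in> M" "e \<noteq> f"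
  then have "convex hull e \<inter> convex hull f = {}"
    using assms by (auto simp: non_crossing_def)
  then show "e \<inter> f = {}"
    using hull_subset[of e convex] hull_subset[of f convex] by blast
qed

text \<open>Induction over the arrivals. Disjointness comes from the non-crossing clause of
  legality; a new edge has two distinct endpoints because its partner arrived earlier and the new
  point is fresh.\<close>

lemma matching_on_parabola_matching:
  assumes A: "revocable_algorithm \<I> A" and sub: "unit_weight_inputs \<subseteq> \<I>"
    and "distinct xs"
  shows "matching_on (parabola_point ` set xs) (parabola_matching A xs)"
  using assms(3)
proof (induction xs rule: rev_induct)
  case Nil
  then show ?case by (simp add: matching_on_def)
next
  case (snoc x xs)
  obtain r m where rm: "A (parabola_input (xs @ [x])) = (r, m)" by fastforce
  have legal: "legal_decision (parabola_point ` set xs) (parabola_point x)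
      (parabola_matching A xs) (r, m)"
    using parabola_legal_decision[OF A sub snoc.prems] rm by simp
  have M: "parabola_matching A (xs @ [x]) =
      add_edge (parabola_point x) m (remove_edge r (parabola_matching A xs))"
    using rm by (rule parabola_matching_snoc)
  have "pairwise disjnt (parabola_matching A (xs @ [x]))"
    using legal non_crossing_pairwise_disjnt unfolding M legal_decision_def by (simp add: Let_def)
  moreover have "e \<subseteq> parabola_point ` set (xs @ [x]) \<and> card e = 2"
    if e: "e \<in> parabola_matching A (xs @ [x])" for e
  proof -
    have IH: "\<forall>e\<in>parabola_matching A xs. e \<subseteq> parabola_point ` set xs \<and> card e = 2"
      using snoc by (simp add: matching_on_def)
    consider "e \<in> parabola_matching A xs" | q where "m = Some q" "e = {parabola_point x, q}"
      using e by (auto simp: M add_edge_def remove_edge_def split: option.splits if_splits)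
    then show ?thesis
    proof cases
      case 1
      then show ?thesis using IH by auto
    next
      case 2
      then have "q \<in> parabola_point ` set xs"
        using legal by (simp add: legal_decision_def Let_def)
      then show ?thesis using 2 snoc.prems by (auto simp: card_insert_if)
    qed
  qed
  ultimately show ?case by (simp add: matching_on_def)
qed

lemma alg_profit_parabola_input:
  assumes "distinct xs" "matching_on (parabola_point ` set xs) (parabola_matching A xs)"
  shows "alg_profit A (parabola_input xs) = 2 * card (parabola_matching A xs)"
proof -
  let ?M = "parabola_matching A xs"
  have "alg_profit A (parabola_input xs) =
      (\<Sum>x\<leftarrow>xs. if parabola_point x \<in> \<Union>?M then 1 else 0)"
    by (simp add: alg_profit_def parabola_input_def parabola_matching_def o_def)
  also have "\<dots> = (\<Sum>x\<in>set xs. if parabola_point x \<in> \<Union>?M then 1 else 0)"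
    using assms(1) by (rule sum_list_distinct_conv_sum_set)
  also have "\<dots> = card {x \<in> set xs. parabola_point x \<in> \<Union>?M}"
    by (subst sum.inter_filter[symmetric]) auto
  also have "\<dots> = card (parabola_point ` {x \<in> set xs. parabola_point x \<in> \<Union>?M})"
    by (simp add: card_image inj_on_def)
  also have "parabola_point ` {x \<in> set xs. parabola_point x \<in> \<Union>?M} = \<Union>?M"
  proof -
    have "\<Union>?M \<subseteq> parabola_point ` set xs"
      using assms(2) unfolding matching_on_def by blast
    then show ?thesis by blast
  qed
  also have "card (\<Union>?M) = 2 * card ?M"
    using assms(2) by (rule matching_on_card_Union) simp
  finally show ?thesis by simp
qed

section \<open>Existence of a blocked point\<close>

lemma ex_just_above:
  fixes a :: real
  assumes "finite X"
  shows "\<exists>x>a. \<forall>y\<in>X. a < y \<longrightarrow> x < y"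
  using assms
proof induction
  case empty
  then show ?case using gt_ex by blast
next
  case (insert z X)
  then obtain x where x: "x > a" "\<forall>y\<in>X. a < y \<longrightarrow> x < y" by blast
  show ?case
  proof (cases "a < z")
    case True
    then obtain w where "a < w" "w < min x z"
      using x(1) dense[of a "min x z"] by auto
    with x show ?thesis by (intro exI[of _ w]) auto
  qed (use x in auto)
qed

lemma ex_blocked_point:
  assumes M: "matching_on (parabola_point ` X) M" and X: "finite X"
    and few: "card X < 3 * card M"
  shows "\<exists>x. x \<notin> X \<and> (\<forall>q\<in>X. parabola_point q \<notin> \<Union>M \<longrightarrow>
    (\<exists>e\<in>M. convex hull {parabola_point x, parabola_point q} \<inter> convex hull e \<noteq> {}))"
proof -
  define E where "E = (\<lambda>a b. {parabola_point a, parabola_point b})"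
  define L where "L = {a. \<exists>b>a. E a b \<in> M}"
  define U where "U = {q \<in> X. parabola_point q \<notin> \<Union>M}"
  \<comment> \<open>\<open>Max (C q)\<close> is the left endpoint assigned to \<open>q\<close>. If
    \<open>C q\<close> is empty, the maximum is unspecified, but it still contributes at most one
    value to the count below.\<close>
  define C where "C = (\<lambda>q. {c. c < q \<and> (\<exists>d>q. E c d \<in> M)})"
  have edge: "a \<in> X" "b \<in> X" if "E a b \<in> M" for a b
    using that M unfolding matching_on_def E_def by fastforce+
  have "L \<subseteq> X"
    using edge by (auto simp: L_def)
  then have "finite L" using X by (rule finite_subset)
  have finC: "finite (C q)" for q
    by (rule finite_subset[OF _ X]) (auto simp: C_def edge)
  \<comment> \<open>Edges are disjoint, so each one is determined by its left endpoint. Hence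
    \<open>L\<close> has at least as many elements as \<open>M\<close>.\<close>
  have "M \<subseteq> (\<lambda>a. THE e. e \<in> M \<and> parabola_point a \<in> e) ` L"
  proof
    fix e assume e: "e \<in> M"
    then have "e \<subseteq> parabola_point ` X" "card e = 2"
      using M by (auto simp: matching_on_def)
    then obtain u v where uv: "e = E u v" "u \<noteq> v"
      by (auto simp: card_2_iff E_def)
    then obtain a b where ab: "e = E a b" "a < b"
      by (metis E_def insert_commute linorder_neqE)
    have "(THE e'. e' \<in> M \<and> parabola_point a \<in> e') = e"
    proof (rule the_equality)
      show "e \<in> M \<and> parabola_point a \<in> e" using e ab by (simp add: E_def)
      fix e' assume e': "e' \<in> M \<and> parabola_point a \<in> e'"
      have "parabola_point a \<in> e" using ab by (simp add: E_def)
      then show "e' = e"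
        using M e e' unfolding matching_on_def pairwise_def disjnt_iff by blast
    qed
    moreover have "a \<in> L" using e ab by (auto simp: L_def)
    ultimately show "e \<in> (\<lambda>a. THE e. e \<in> M \<and> parabola_point a \<in> e) ` L" by blast
  qed
  then have "card M \<le> card L"
    using \<open>finite L\<close> by (rule surj_card_le[rotated])
  have "card U = card (parabola_point ` U)"
    by (simp add: card_image inj_on_def)
  also have "parabola_point ` U = parabola_point ` X - \<Union>M"
    by (auto simp: U_def)
  also have "card \<dots> = card (parabola_point ` X) - card (\<Union>M)"
    using matching_on_finite(2)[OF M] M X
    by (intro card_Diff_subset) (auto simp: matching_on_def)
  also have "\<dots> = card X - 2 * card M"
    using M X by (simp add: matching_on_card_Union card_image inj_on_def)
  \<comment> \<open>The truncated subtraction is harmless, since \<open>few\<close> forces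
    \<open>card M\<close> to be positive.\<close>
  finally have "card U < card M"
    using few by linarith
  have "finite U" using X by (simp add: U_def)
  have "card ((\<lambda>q. Max (C q)) ` U) < card L"
    using card_image_le[OF \<open>finite U\<close>, of "\<lambda>q. Max (C q)"] \<open>card U < card M\<close>
      \<open>card M \<le> card L\<close> by linarith
  then have "\<not> L \<subseteq> (\<lambda>q. Max (C q)) ` U"
    using \<open>finite U\<close> by (meson card_mono finite_imageI leD)
  then obtain a where a: "a \<in> L" "\<And>q. q \<in> U \<Longrightarrow> Max (C q) \<noteq> a" by blast
  then obtain b where b: "a < b" "E a b \<in> M" by (auto simp: L_def)
  obtain x where x: "a < x" "\<And>y. y \<in> X \<Longrightarrow> a < y \<Longrightarrow> x < y"
    using ex_just_above[OF X, of a] by blast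
  have "x < b" using x edge b by blast
  have "x \<notin> X" using x by blast
  moreover have "\<exists>e\<in>M. convex hull E x q \<inter> convex hull e \<noteq> {}" if q: "q \<in> U" for q
  proof -
    \<comment> \<open>As \<open>x\<close> lies strictly between \<open>a\<close> and
      \<open>b\<close>, a chord from \<open>x\<close> to a point outside that interval crosses the
      edge \<open>E a b\<close>. Only \<open>q\<close> between \<open>a\<close> and \<open>b\<close>
      needs another edge.\<close>
    have "q \<in> X" "q \<noteq> a" "q \<noteq> b"
      using q b by (auto simp: U_def E_def)
    then consider "q < a" | "b < q" | "a < q" "q < b" by linarith
    then show ?thesis
    proof cases
      case 1
      then have "convex hull E q x \<inter> convex hull E a b \<noteq> {}"
        using parabola_chords_cross x(1) \<open>x < b\<close> by (simp add: E_def)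
      then show ?thesis using b by (metis E_def insert_commute)
    next
      case 2
      then have "convex hull E a b \<inter> convex hull E x q \<noteq> {}"
        using parabola_chords_cross x(1) \<open>x < b\<close> by (simp add: E_def)
      then show ?thesis using b by blast
    next
      case 3
      then have "a \<in> C q" using b by (auto simp: C_def)
      define c where "c = Max (C q)"
      have "c \<in> C q" "a \<le> c"
        unfolding c_def using Max_in[OF finC] Max_ge[OF finC] \<open>a \<in> C q\<close> by blast+
      then obtain d where d: "c < q" "q < d" "E c d \<in> M" by (auto simp: C_def)
      \<comment> \<open>Here \<open>a\<close> belongs to \<open>C q\<close> but is not its maximum.
        No old abscissa lies between \<open>a\<close> and \<open>x\<close>, so
        \<open>x < c < q < d\<close> and the chords interleave.\<close>
      have "a < c" using \<open>a \<le> c\<close> a(2)[OF q] by (simp add: c_def)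
      then have "x < c" using x(2) edge d by blast
      then have "convex hull E x q \<inter> convex hull E c d \<noteq> {}"
        using parabola_chords_cross d by (simp add: E_def)
      then show ?thesis using d by blast
    qed
  qed
  ultimately show ?thesis
    by (intro exI[of _ x]) (auto simp: U_def E_def)
qed

section \<open>The invariant of the adversary\<close>

lemma card_remove_edge:
  "finite M \<Longrightarrow> \<forall>e. r = Some e \<longrightarrow> e \<in> M \<Longrightarrow>
    card (remove_edge r M) = (if r = None then card M else card M - 1)"
  by (auto simp: remove_edge_def split: option.splits)

lemma card_add_edge_le: "card (add_edge p m M) \<le> (if m = None then card M else Suc (card M))"
  by (auto simp: add_edge_def card_insert_le_m1 split: option.splits intro: card_insert_le)

text \<open>The adversary is adaptive, but since \<open>A\<close> is a function of the prefix, its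
  choices amount to one fixed list for each length.\<close>

lemma parabola_adversary:
  assumes A: "revocable_algorithm \<I> A" and sub: "unit_weight_inputs \<subseteq> \<I>"
  shows "\<exists>xs. distinct xs \<and> length xs = n \<and> 3 * card (parabola_matching A xs) \<le> n + 2"
proof (induction n)
  case 0
  then show ?case by simp
next
  case (Suc n)
  then obtain xs where xs: "distinct xs" "length xs = n"
    and le: "3 * card (parabola_matching A xs) \<le> n + 2" by blast
  let ?M = "parabola_matching A xs"
  have M: "matching_on (parabola_point ` set xs) ?M"
    by (rule matching_on_parabola_matching[OF A sub xs(1)])
  have finM: "finite ?M"
    using M by (rule matching_on_finite) simp
  show ?case
  proof (cases "3 * card ?M \<le> n")
    case True
    obtain x where x: "x \<notin> set xs"
      using ex_new_if_finite[OF infinite_UNIV_char_0 finite_set] by blast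
    obtain r m where rm: "A (parabola_input (xs @ [x])) = (r, m)" by fastforce
    have "card (remove_edge r ?M) \<le> card ?M"
      using finM by (auto simp: remove_edge_def card_Diff1_le split: option.splits)
    \<comment> \<open>One extra edge costs 3 on the left, and \<open>n + 3 = Suc n + 2\<close>; this
      explains the slack of 2.\<close>
    then have "card (parabola_matching A (xs @ [x])) \<le> Suc (card ?M)"
      using card_add_edge_le[of "parabola_point x" m "remove_edge r ?M"]
      unfolding parabola_matching_snoc[of A xs x, OF rm] by (auto split: if_splits)
    with True x xs show ?thesis by (intro exI[of _ "xs @ [x]"]) auto
  next
    case False
    then have "card (set xs) < 3 * card ?M"
      using xs by (simp add: distinct_card)
    then obtain x where x: "x \<notin> set xs"
      and blocked: "\<And>q. q \<in> set xs \<Longrightarrow> parabola_point q \<notin> \<Union>?M \<Longrightarrow>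
        \<exists>e\<in>?M. convex hull {parabola_point x, parabola_point q} \<inter> convex hull e \<noteq> {}"
      using ex_blocked_point[OF M finite_set] by blast
    obtain r m where rm: "A (parabola_input (xs @ [x])) = (r, m)" by fastforce
    have legal: "legal_decision (parabola_point ` set xs) (parabola_point x) ?M (r, m)"
      using parabola_legal_decision[OF A sub, of xs x] x xs rm by simp
    \<comment> \<open>Without a removal, the partner \<open>q\<close> is unmatched in
      \<open>?M\<close>, so the new edge differs from every old one and crosses some of
      them.\<close>
    have "\<not> (r = None \<and> m \<noteq> None)"
    proof
      assume "r = None \<and> m \<noteq> None"
      then obtain q where r: "r = None" and q: "m = Some (parabola_point q)" "q \<in> set xs"
        "parabola_point q \<notin> \<Union>?M"
        using legal by (auto simp: legal_decision_def remove_edge_def Let_def)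
      let ?e = "{parabola_point x, parabola_point q}"
      have "non_crossing (insert ?e ?M)"
        using legal r q by (simp add: legal_decision_def remove_edge_def add_edge_def)
      moreover obtain e where e: "e \<in> ?M" "convex hull ?e \<inter> convex hull e \<noteq> {}"
        using blocked q by blast
      moreover have "?e \<noteq> e" using e(1) q(3) by blast
      ultimately show False by (auto simp: non_crossing_def)
    qed
    moreover have r: "\<forall>e. r = Some e \<longrightarrow> e \<in> ?M"
      using legal by (simp add: legal_decision_def Let_def)
    \<comment> \<open>This makes one removal followed by one insertion cancel despite truncated
      subtraction.\<close>
    moreover have "card ?M > 0" using False by simp
    ultimately have "card (parabola_matching A (xs @ [x])) \<le> card ?M"
      using card_add_edge_le[of "parabola_point x" m "remove_edge r ?M"] card_remove_edge[OF finM r]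
      unfolding parabola_matching_snoc[of A xs x, OF rm] by (auto split: if_splits)
    with le x xs show ?thesis by (intro exI[of _ "xs @ [x]"]) auto
  qed
qed

section \<open>From the invariant to the competitive ratio\<close>

lemma competitive_le:
  assumes A: "revocable_algorithm \<I> A" and sub: "unit_weight_inputs \<subseteq> \<I>"
    and "competitive \<I> A \<rho>"
  shows "\<rho> \<le> 2 / 3"
proof (rule ccontr)
  assume "\<not> \<rho> \<le> 2 / 3"
  obtain c where c: "\<And>I. I \<in> \<I> \<Longrightarrow> alg_profit A I \<ge> \<rho> * opt_profit I - c"
    using assms(3) by (auto simp: competitive_def)
  \<comment> \<open>On \<open>2 * n\<close> points the profit is at most
    \<open>2 * (2 * n + 2) / 3\<close>, while the optimum is \<open>2 * n\<close>. A ratio above 2/3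
    makes the left side unbounded in \<open>n\<close>.\<close>
  have bound: "real n * (2 * \<rho> - 4 / 3) \<le> 4 / 3 + c" for n
  proof -
    obtain xs where xs: "distinct xs" "length xs = 2 * n"
      "3 * card (parabola_matching A xs) \<le> 2 * n + 2"
      using parabola_adversary[OF A sub] by blast
    have "\<rho> * (2 * real n) - c \<le> 2 * real (card (parabola_matching A xs))"
      using c[OF subsetD[OF sub parabola_input_unit_weight[OF xs(1)]]] xs
        alg_profit_parabola_input[OF xs(1) matching_on_parabola_matching[OF A sub xs(1)]]
      by (simp add: opt_profit_parabola_input)
    moreover have "3 * real (card (parabola_matching A xs)) \<le> 2 * real n + 2"
      using xs(3) by linarith
    ultimately show ?thesis by (simp add: algebra_simps)
  qed
  have "2 * \<rho> - 4 / 3 > 0" using \<open>\<not> \<rho> \<le> 2 / 3\<close> by simp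
  then obtain n where "4 / 3 + c < real n * (2 * \<rho> - 4 / 3)"
    using reals_Archimedean3 by blast
  with bound[of n] show False by simp
qed

text \<open>Keeping \<open>\<I>\<close> general covers both algorithms that must be legal on unit
  weights only and those that must be legal on all inputs.\<close>

lemma competitive_ratio_le:
  assumes "revocable_algorithm \<I> A" "unit_weight_inputs \<subseteq> \<I>"
  shows "competitive_ratio \<I> A \<le> ereal (2 / 3)"
  unfolding competitive_ratio_def using competitive_le[OF assms] by (auto intro!: Sup_least)

theorem theorem10:
  "(\<forall>A. revocable_algorithm unit_weight_inputs A \<longrightarrow>
        competitive_ratio unit_weight_inputs A \<le> ereal (2/3)) \<and>
   (\<forall>A. revocable_algorithm ownm_inputs A \<longrightarrow>
        competitive_ratio ownm_inputs A \<le> ereal (2/3))"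
proof -
  have "unit_weight_inputs \<subseteq> ownm_inputs"
    by (auto simp: unit_weight_inputs_def)
  then show ?thesis
    by (auto intro: competitive_ratio_le)
qed

end
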